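(* Let $T^*:[0,1]^2\to[0,1]$ be an associative monotone function with a neutral element in $[0,1]$. Let $M\in\mathcal{A}$ be the range of a non-constant non-decreasing right continuous function $f:[0,1]\to[0,1]$ with $f(1)=1$, and let $(\mathcal{S},\mathcal{C})=(\{[b_k,d_k]\mid k\in K\},\{c_k\mid k\in\overline{K}\})$ be associated with $M$. Then $(M,\otimes)$ is a semigroup (i.e. the operation $\otimes$ on $M$ is associative) if and only if $\mathfrak{T}(M)\cap M=\emptyset$.
   Context: $\mathcal{A}$ is the family of all sets $M\subseteq[0,1]$ for which there is a non-decreasing right continuous function $f:[0,1]\to[0,1]$ with $\mathrm{Ran}(f)=M$; then $f(1)=\max M$. A pair $(\mathcal{S},\mathcal{C})$ is associated with $M\in\mathcal{A}$, $M\neq[0,f(1)]$, if: $\mathcal{S}=\{[b_k,d_k]\subseteq[0,1]\mid k\in K\}$ is a non-empty countable (possibly finite) system of closed intervals of positive length such that for any two distinct members $[b_k,d_k],[b_l,d_l]$ either $[b_k,d_k]\cap[b_l,d_l]=\emptyset$, or $[b_k,d_k]\cap[b_l,d_l]=\{d_k\}$ when $d_k\le b_l$; $\mathcal{C}=\{c_k\in[0,1]\mid k\in\overline{K}\}$ is a non-empty countable set such that for all $k\in K$, $[b_k,d_k]\cap\mathcal{C}=\{d_k\}$ or $[b_k,d_k]\cap\mathcal{C}=\{b_k,d_k\}$; and $M=\{c_k\mid k\in\overline{K}\}\cup\big([0,f(1)]\setminus\bigcup_{k\in K}[b_k,d_k]\big)$. If $M=[0,f(1)]$, the associated pair is $\mathcal{S}=\{[f(1),f(1)]\}$,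 $\mathcal{C}=\{f(1)\}$. "Monotone" for $T^*$ means non-decreasing in each variable, or non-increasing in each variable. $G_M:[0,1]\to M$ is $G_M(x)=\inf([x,1]\cap M)$ if $x<f(1)$ and $G_M(x)=f(1)$ otherwise. The operation $\otimes:M^2\to M$ is $x\otimes y=G_M(T^*(x,y))$. For $A\subseteq[0,1]$, $O(A)=\bigcup_{x,y\in A}[\min\{x,y\},\max\{x,y\})$ (with $[x,x)=\emptyset$), and $O(\emptyset)=\emptyset$. For $A\subseteq[0,1]$ and $c\in[0,1]$, $T^*(A,c)=\{T^*(x,c)\mid x\in A\}$ and $T^*(c,A)=\{T^*(c,x)\mid x\in A\}$ (empty if $A$ is empty). For $y\in M$ and $k,l\in K$: $M_k^y=\{x\in M\mid T^*(x,y)\in(b_k,d_k)\text{ if } b_k\in M,\ T^*(x,y)\in[b_k,d_k)\text{ if } b_k\notin M\}$; $M_y^k=\{x\in M\mid T^*(y,x)\in(b_k,d_k)\text{ if } b_k\in M,\ T^*(y,x)\in[b_k,d_k)\text{ if } b_k\notin M\}$; $M^y=\{x\in M\mid T^*(x,y)\in M\}$; $M_y=\{x\in M\mid T^*(y,x)\in M\}$; $I_k^y=\{d_k\}\cup T^*(M_k^y,y)$; $I_y^k=\{d_k\}\cup T^*(y,M_y^k)$; $J_{k,l}^y=O\big(T^*(M_k^y,d_l)\cup T^*(d_k,M_y^l)\big)$ if $M_k^y\ne\emptyset$ and $M_y^l\neq\emptyset$, and $J_{k,l}^y=\emptyset$ otherwise. $\mathfrak{T}_1(M)=\bigcup_{y\in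 M}\bigcup_{k\in K}\bigcup_{t\in M_y}O(T^*(I_k^y,t))$; $\mathfrak{T}_2(M)=\bigcup_{y\in M}\bigcup_{k\in K}\bigcup_{t\in M^y}O(T^*(t,I_y^k))$; $\mathfrak{T}_3(M)=\bigcup_{y\in M}\bigcup_{k,l\in K}J_{k,l}^y$; $\mathfrak{T}(M)=\mathfrak{T}_1(M)\cup\mathfrak{T}_2(M)\cup\mathfrak{T}_3(M)$. *)

theory Defs
  imports "HOL-Analysis.Analysis"
begin

text \<open>
  Functions on the unit interval (square) are total functions on the reals of which only the
  values on \<open>{0..1}\<close> matter. Right continuity is required on \<open>{0..<1}\<close>: at the right end
  point of the domain it is vacuous.
\<close>

definition unit_rc_mono :: "(real \<Rightarrow> real) \<Rightarrow> bool" where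
  "unit_rc_mono f \<longleftrightarrow>
     f \<in> {0..1} \<rightarrow> {0..1} \<and> mono_on {0..1} f \<and> (\<forall>x\<in>{0..<1}. continuous (at_right x) f)"

text \<open>The family \<open>\<A>\<close> of the ranges of such functions.\<close>

definition range_family :: "real set set" where
  "range_family = {M. \<exists>f. unit_rc_mono f \<and> f ` {0..1} = M}"

text \<open>The maximum of a set of reals that may be infinite; it equals \<open>f 1\<close> if \<open>M = f ` {0..1}\<close>.\<close>

definition max_of :: "real set \<Rightarrow> real" where
  "max_of M = (GREATEST m. m \<in> M)"

text \<open>
  The pair \<open>({[b\<^sub>k, d\<^sub>k] | k \<in> K}, {c\<^sub>k | k \<in> K'})\<close> is given by its indexing families,
  because the sets below refer to the end points \<open>b\<^sub>k\<close>, \<open>d\<^sub>k\<close>. The indexing need not be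
  injective: "distinct members" means distinct intervals.
\<close>

definition associated_pair ::
  "real set \<Rightarrow> 'k set \<Rightarrow> ('k \<Rightarrow> real) \<Rightarrow> ('k \<Rightarrow> real) \<Rightarrow> 'l set \<Rightarrow> ('l \<Rightarrow> real) \<Rightarrow> bool" where
  "associated_pair M K b d K' c \<longleftrightarrow>
     M \<in> range_family \<and>
     (if M = {0..max_of M}
      then (\<lambda>k. {b k..d k}) ` K = {{max_of M..max_of M}} \<and> c ` K' = {max_of M}
      else
        K \<noteq> {} \<and> countable ((\<lambda>k. {b k..d k}) ` K) \<and>
        (\<forall>k\<in>K. {b k..d k} \<subseteq> {0..1} \<and> b k < d k) \<and>
        (\<forall>k\<in>K. \<forall>l\<in>K. {b k..d k} \<noteq> {b l..d l} \<longrightarrow>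
           {b k..d k} \<inter> {b l..d l} = {} \<or>
           d k \<le> b l \<and> {b k..d k} \<inter> {b l..d l} = {d k} \<or>
           d l \<le> b k \<and> {b k..d k} \<inter> {b l..d l} = {d l}) \<and>
        K' \<noteq> {} \<and> countable (c ` K') \<and> c ` K' \<subseteq> {0..1} \<and>
        (\<forall>k\<in>K. {b k..d k} \<inter> c ` K' = {d k} \<or> {b k..d k} \<inter> c ` K' = {b k, d k}) \<and>
        M = c ` K' \<union> ({0..max_of M} - (\<Union>k\<in>K. {b k..d k})))"

definition assoc_on :: "'a set \<Rightarrow> ('a \<Rightarrow> 'a \<Rightarrow> 'a) \<Rightarrow> bool" where
  "assoc_on A op \<longleftrightarrow> (\<forall>x\<in>A. \<forall>y\<in>A. \<forall>z\<in>A. op (op x y) z = op x (op y z))"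

definition semigroup_on :: "'a set \<Rightarrow> ('a \<Rightarrow> 'a \<Rightarrow> 'a) \<Rightarrow> bool" where
  "semigroup_on A op \<longleftrightarrow> (\<forall>x\<in>A. \<forall>y\<in>A. op x y \<in> A) \<and> assoc_on A op"

definition monotone_op :: "(real \<Rightarrow> real \<Rightarrow> real) \<Rightarrow> bool" where
  "monotone_op T \<longleftrightarrow>
     (\<forall>z\<in>{0..1}. mono_on {0..1} (\<lambda>x. T x z) \<and> mono_on {0..1} (\<lambda>x. T z x)) \<or>
     (\<forall>z\<in>{0..1}. antimono_on {0..1} (\<lambda>x. T x z) \<and> antimono_on {0..1} (\<lambda>x. T z x))"

definition G :: "real set \<Rightarrow> real \<Rightarrow> real" where
  "G M x = (if x < max_of M then Inf ({x..1} \<inter> M) else max_of M)"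

definition otimes :: "(real \<Rightarrow> real \<Rightarrow> real) \<Rightarrow> real set \<Rightarrow> real \<Rightarrow> real \<Rightarrow> real" where
  "otimes T M x y = G M (T x y)"

definition O_set :: "real set \<Rightarrow> real set" where
  "O_set A = (\<Union>x\<in>A. \<Union>y\<in>A. {min x y..<max x y})"

text \<open>
  The gap of \<open>M\<close> inside \<open>[b, d]\<close>. With it, \<open>M_lower T M b\<^sub>k d\<^sub>k y\<close> is \<open>M\<^sub>k\<^sup>y\<close>,
  \<open>M_upper T M b\<^sub>k d\<^sub>k y\<close> is \<open>M\<^sub>y\<^sup>k\<close>, and \<open>I_lower\<close>, \<open>I_upper\<close> are \<open>I\<^sub>k\<^sup>y\<close>, \<open>I\<^sub>y\<^sup>k\<close>:
  lower and upper refer to the position of the index \<open>k\<close>. Likewise \<open>M_left\<close> is \<open>M\<^sup>y\<close>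
  (the variable is the left argument) and \<open>M_right\<close> is \<open>M\<^sub>y\<close>.
\<close>

definition gap :: "real set \<Rightarrow> real \<Rightarrow> real \<Rightarrow> real set" where
  "gap M b d = (if b \<in> M then {b<..<d} else {b..<d})"

definition M_lower :: "(real \<Rightarrow> real \<Rightarrow> real) \<Rightarrow> real set \<Rightarrow> real \<Rightarrow> real \<Rightarrow> real \<Rightarrow> real set" where
  "M_lower T M b d y = {x \<in> M. T x y \<in> gap M b d}"

definition M_upper :: "(real \<Rightarrow> real \<Rightarrow> real) \<Rightarrow> real set \<Rightarrow> real \<Rightarrow> real \<Rightarrow> real \<Rightarrow> real set" where
  "M_upper T M b d y = {x \<in> M. T y x \<in> gap M b d}"

definition M_left :: "(real \<Rightarrow> real \<Rightarrow> real) \<Rightarrow> real set \<Rightarrow> real \<Rightarrow> real set" where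
  "M_left T M y = {x \<in> M. T x y \<in> M}"

definition M_right :: "(real \<Rightarrow> real \<Rightarrow> real) \<Rightarrow> real set \<Rightarrow> real \<Rightarrow> real set" where
  "M_right T M y = {x \<in> M. T y x \<in> M}"

definition I_lower :: "(real \<Rightarrow> real \<Rightarrow> real) \<Rightarrow> real set \<Rightarrow> real \<Rightarrow> real \<Rightarrow> real \<Rightarrow> real set" where
  "I_lower T M b d y = {d} \<union> (\<lambda>x. T x y) ` M_lower T M b d y"

definition I_upper :: "(real \<Rightarrow> real \<Rightarrow> real) \<Rightarrow> real set \<Rightarrow> real \<Rightarrow> real \<Rightarrow> real \<Rightarrow> real set" where
  "I_upper T M b d y = {d} \<union> T y ` M_upper T M b d y"

definition J_set ::
  "(real \<Rightarrow> real \<Rightarrow> real) \<Rightarrow> real set \<Rightarrow> ('k \<Rightarrow> real) \<Rightarrow> ('k \<Rightarrow> real) \<Rightarrow> 'k \<Rightarrow> 'k \<Rightarrow> real \<Rightarrow> real set"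
where
  "J_set T M b d k l y =
     (if M_lower T M (b k) (d k) y \<noteq> {} \<and> M_upper T M (b l) (d l) y \<noteq> {}
      then O_set ((\<lambda>x. T x (d l)) ` M_lower T M (b k) (d k) y \<union>
                  T (d k) ` M_upper T M (b l) (d l) y)
      else {})"

definition T1_set ::
  "(real \<Rightarrow> real \<Rightarrow> real) \<Rightarrow> real set \<Rightarrow> 'k set \<Rightarrow> ('k \<Rightarrow> real) \<Rightarrow> ('k \<Rightarrow> real) \<Rightarrow> real set" where
  "T1_set T M K b d =
     (\<Union>y\<in>M. \<Union>k\<in>K. \<Union>t\<in>M_right T M y. O_set ((\<lambda>x. T x t) ` I_lower T M (b k) (d k) y))"

definition T2_set ::
  "(real \<Rightarrow> real \<Rightarrow> real) \<Rightarrow> real set \<Rightarrow> 'k set \<Rightarrow> ('k \<Rightarrow> real) \<Rightarrow> ('k \<Rightarrow> real) \<Rightarrow> real set" where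
  "T2_set T M K b d =
     (\<Union>y\<in>M. \<Union>k\<in>K. \<Union>t\<in>M_left T M y. O_set (T t ` I_upper T M (b k) (d k) y))"

definition T3_set ::
  "(real \<Rightarrow> real \<Rightarrow> real) \<Rightarrow> real set \<Rightarrow> 'k set \<Rightarrow> ('k \<Rightarrow> real) \<Rightarrow> ('k \<Rightarrow> real) \<Rightarrow> real set" where
  "T3_set T M K b d = (\<Union>y\<in>M. \<Union>k\<in>K. \<Union>l\<in>K. J_set T M b d k l y)"

definition T_set ::
  "(real \<Rightarrow> real \<Rightarrow> real) \<Rightarrow> real set \<Rightarrow> 'k set \<Rightarrow> ('k \<Rightarrow> real) \<Rightarrow> ('k \<Rightarrow> real) \<Rightarrow> real set" where
  "T_set T M K b d = T1_set T M K b d \<union> T2_set T M K b d \<union> T3_set T M K b d"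

end

theory Submission
  imports Defs
begin

text \<open>
  Right continuity makes \<open>M\<close> closed under infima, so \<open>G M x\<close> is the least element of \<open>M\<close>
  above \<open>x\<close> (\<open>G_least\<close>). Two consequences carry the proof. First, the points outside \<open>M\<close> are
  exactly those of the gaps, and \<open>G M\<close> sends the gap of \<open>[b k, d k]\<close> to \<open>d k\<close>. Secondly,
  \<open>O_set A\<close> misses \<open>M\<close> if and only if \<open>G M\<close> is constant on \<open>A\<close>, because an element of \<open>M\<close> in
  \<open>[u, v)\<close> is precisely what separates \<open>G M u\<close> from \<open>G M v\<close> (\<open>O_set_disjoint_iff\<close>).

  Associativity of \<open>\<otimes>\<close> at \<open>(x, y, z)\<close> is
  \<open>G (T (G (T x y)) z) = G (T x (G (T y z)))\<close>, where \<open>G\<close> is \<open>G M\<close>. The inner \<open>G\<close> is the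
  identity on \<open>M\<close> and is \<open>d k\<close> on the \<open>k\<close>-th gap, so there are four cases:

  \<^item> \<open>T x y\<close> and \<open>T y z\<close> both lie in \<open>M\<close>: associativity of \<open>T\<close> gives the equation;
  \<^item> \<open>T x y\<close> lies in gap \<open>k\<close> and \<open>T y z\<close> in \<open>M\<close>: by associativity of \<open>T\<close> the equation is
    \<open>G (T (d k) z) = G (T (T x y) z)\<close>;
  \<^item> \<open>T x y\<close> lies in \<open>M\<close> and \<open>T y z\<close> in gap \<open>l\<close>: likewise
    \<open>G (T x (T y z)) = G (T x (d l))\<close>;
  \<^item> \<open>T x y\<close> lies in gap \<open>k\<close> and \<open>T y z\<close> in gap \<open>l\<close>: it is
    \<open>G (T (d k) z) = G (T x (d l))\<close>.

  In each of the last three cases, collecting the equations with the gap indices fixed says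
  that \<open>G\<close> is constant on a set \<open>A\<close> whose \<open>O_set A\<close> is one of the pieces of \<open>T1_set\<close>,
  \<open>T2_set\<close> and \<open>T3_set\<close> respectively.
\<close>

section \<open>The least element of the range above a point\<close>

text \<open>
  The infimum of the parameters \<open>u\<close> with \<open>x \<le> f u\<close> is again such a parameter by right
  continuity, and by monotonicity its value is the least one.
\<close>

lemma unit_rc_mono_least_above:
  assumes f: "unit_rc_mono f" and x: "x \<le> f 1"
  obtains s where "s \<in> {0..1}" "x \<le> f s" "\<And>u. u \<in> {0..1} \<Longrightarrow> x \<le> f u \<Longrightarrow> f s \<le> f u"
proof -
  define S where "S = {u \<in> {0..1}. x \<le> f u}"
  define s where "s = Inf S"
  have mono: "mono_on {0..1} f" and cont: "\<And>u. u \<in> {0..<1} \<Longrightarrow> continuous (at_right u) f"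
    using f by (auto simp: unit_rc_mono_def)
  have one: "1 \<in> S" using x by (auto simp: S_def)
  have bdd: "bdd_below S" by (rule bdd_belowI[of _ 0]) (auto simp: S_def)
  have s_le: "s \<le> u" if "u \<in> S" for u
    unfolding s_def using that bdd by (rule cInf_lower)
  have "0 \<le> s"
    unfolding s_def using one by (intro cInf_greatest) (auto simp: S_def)
  with s_le[OF one] have s01: "s \<in> {0..1}" by simp
  have "x \<le> f s"
  proof (cases "s = 1")
    case True
    then show ?thesis using x by simp
  next
    case False
    with s01 have s1: "s < 1" by simp
    have above: "x \<le> f u" if u: "s < u" "u < 1" for u
    proof -
      have "\<exists>v\<in>S. v < u"
        using cInf_less_iff[of S u] one bdd u(1) by (auto simp: s_def)
      then obtain v where v: "v \<in> S" "v < u" by blast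
      have "f v \<le> f u"
        using v u s01 by (intro mono_onD[OF mono]) (auto simp: S_def)
      then show ?thesis using v by (simp add: S_def)
    qed
    have "(f \<longlongrightarrow> f s) (at_right s)"
      using cont[of s] s01 s1 by (simp add: continuous_within)
    moreover have "\<forall>\<^sub>F u in at_right s. x \<le> f u"
      unfolding eventually_at_right[OF s1] using s1 above by blast
    ultimately show ?thesis
      by (rule tendsto_lowerbound) simp
  qed
  moreover have "f s \<le> f u" if "u \<in> {0..1}" "x \<le> f u" for u
    using that s01 s_le[of u] by (intro mono_onD[OF mono]) (auto simp: S_def)
  ultimately show thesis using that s01 by blast
qed

lemma max_of_range:
  assumes "unit_rc_mono f"
  shows "max_of (f ` {0..1}) = f 1"
  unfolding max_of_def
proof (rule Greatest_equality)
  show "u \<le> f 1" if "u \<in> f ` {0..1}" for u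
    using assms that by (auto simp: unit_rc_mono_def intro: mono_onD)
qed auto

lemma G_least:
  assumes f: "unit_rc_mono f" and f1: "f 1 = 1" and M: "M = f ` {0..1}" and x: "x \<in> {0..1}"
  shows "G M x \<in> M" and "x \<le> G M x" and "\<And>m. m \<in> M \<Longrightarrow> x \<le> m \<Longrightarrow> G M x \<le> m"
proof -
  have max: "max_of M = 1" using max_of_range[OF f] f1 M by simp
  obtain s where s: "s \<in> {0..1}" "x \<le> f s" "\<And>u. u \<in> {0..1} \<Longrightarrow> x \<le> f u \<Longrightarrow> f s \<le> f u"
    using unit_rc_mono_least_above[OF f, of x] x f1 by auto
  have M01: "M \<subseteq> {0..1}" using f M by (auto simp: unit_rc_mono_def)
  have "G M x = f s"
  proof (cases "x < 1")
    case True
    have "Inf ({x..1} \<inter> M) = f s"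
    proof (rule cInf_eq_minimum)
      show "f s \<in> {x..1} \<inter> M" using s(1,2) M M01 by (metis IntI atLeastAtMost_iff imageI subsetD)
      show "f s \<le> m" if "m \<in> {x..1} \<inter> M" for m
        using that s(3) M by auto
    qed
    then show ?thesis using True max by (simp add: G_def)
  next
    case False
    have "f s \<in> {0..1}" using s(1) M M01 by blast
    with False s(2) x max show ?thesis by (simp add: G_def)
  qed
  then show "G M x \<in> M" "x \<le> G M x" "\<And>m. m \<in> M \<Longrightarrow> x \<le> m \<Longrightarrow> G M x \<le> m"
    using s M by auto
qed


section \<open>Gaps and the projection\<close>

text \<open>
  A common interface to the two branches of \<^const>\<open>associated_pair\<close>. When \<open>M\<close> is the whole
  interval, its single degenerate member \<open>[1, 1]\<close> has an empty gap because \<open>1 \<in> M\<close>, so the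
  last three conditions hold there as well.
\<close>

locale gap_family =
  fixes M :: "real set" and K :: "'k set" and b d :: "'k \<Rightarrow> real"
  assumes M_subset: "M \<subseteq> {0..1}"
    and G_in: "x \<in> {0..1} \<Longrightarrow> G M x \<in> M"
    and G_ge: "x \<in> {0..1} \<Longrightarrow> x \<le> G M x"
    and G_le: "x \<in> {0..1} \<Longrightarrow> m \<in> M \<Longrightarrow> x \<le> m \<Longrightarrow> G M x \<le> m"
    and d_in: "k \<in> K \<Longrightarrow> d k \<in> M"
    and gap_disjoint: "k \<in> K \<Longrightarrow> gap M (b k) (d k) \<inter> M = {}"
    and gap_cover: "x \<in> {0..1} \<Longrightarrow> x \<notin> M \<Longrightarrow> \<exists>k\<in>K. x \<in> gap M (b k) (d k)"

lemma gap_familyI: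
  assumes f: "unit_rc_mono f" and f1: "f 1 = 1" and M: "M = f ` {0..1}"
    and pair: "associated_pair M K b d K' c"
  shows "gap_family M K b d"
proof
  have max: "max_of M = 1" using max_of_range[OF f] f1 M by simp
  show M01: "M \<subseteq> {0..1}" using f M by (auto simp: unit_rc_mono_def)
  show "G M x \<in> M" "x \<le> G M x" if "x \<in> {0..1}" for x
    using G_least[OF f f1 M that] by blast+
  show "G M x \<le> m" if "x \<in> {0..1}" "m \<in> M" "x \<le> m" for x m
    using G_least(3)[OF f f1 M] that by blast
  have gaps: "(\<forall>k\<in>K. d k \<in> M \<and> gap M (b k) (d k) \<inter> M = {}) \<and>
        (\<forall>x\<in>{0..1} - M. \<exists>k\<in>K. x \<in> gap M (b k) (d k))"
  proof (cases "M = {0..max_of M}")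
    case True
    then have K: "(\<lambda>k. {b k..d k}) ` K = {{1..1}}"
      using pair max by (simp add: associated_pair_def)
    have "b k = 1 \<and> d k = 1" if "k \<in> K" for k
    proof -
      have "{b k..d k} = {1..1}" using K that by blast
      then show ?thesis unfolding Icc_eq_Icc by auto
    qed
    then show ?thesis using True max by (auto simp: gap_def)
  next
    case False
    have ends: "{b k..d k} \<inter> c ` K' = {d k} \<or> {b k..d k} \<inter> c ` K' = {b k, d k}" if "k \<in> K" for k
      using pair False that by (auto simp: associated_pair_def)
    have M_eq: "M = c ` K' \<union> ({0..1} - (\<Union>k\<in>K. {b k..d k}))"
      using pair False max by (simp add: associated_pair_def)
    have d: "d k \<in> M" if "k \<in> K" for k
      using ends[OF that] M_eq by blast
    have gap: "gap M (b k) (d k) \<inter> M = {}" if k: "k \<in> K" for k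
    proof -
      have "m = b k \<or> m = d k" if "m \<in> M" "m \<in> {b k..d k}" for m
      proof -
        have "m \<in> c ` K'" using that k M_eq by blast
        then show ?thesis using ends[OF k] that(2) by blast
      qed
      moreover have "m \<in> {b k..d k}" "m \<noteq> d k" "m = b k \<Longrightarrow> b k \<notin> M"
        if "m \<in> gap M (b k) (d k)" for m
        using that by (auto simp: gap_def split: if_splits)
      ultimately show ?thesis by blast
    qed
    have cover: "\<exists>k\<in>K. x \<in> gap M (b k) (d k)" if x: "x \<in> {0..1}" "x \<notin> M" for x
    proof -
      obtain k where k: "k \<in> K" "x \<in> {b k..d k}" using x M_eq by blast
      have "x \<noteq> d k" "b k \<in> M \<Longrightarrow> x \<noteq> b k" using d[OF k(1)] x(2) by auto
      then have "x \<in> gap M (b k) (d k)" using k(2) by (auto simp: gap_def order_less_le)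
      then show ?thesis using k(1) by blast
    qed
    show ?thesis using d gap cover by blast
  qed
  show "d k \<in> M" "gap M (b k) (d k) \<inter> M = {}" if "k \<in> K" for k
    using gaps that by blast+
  show "\<exists>k\<in>K. x \<in> gap M (b k) (d k)" if "x \<in> {0..1}" "x \<notin> M" for x
    using gaps that by blast
qed

context gap_family
begin

lemma in_I: "x \<in> M \<Longrightarrow> x \<in> {0..1}"
  using M_subset by blast

lemma G_on_M: "x \<in> M \<Longrightarrow> G M x = x"
  using G_ge[of x] G_le[of x x] in_I[of x] by simp

lemma G_on_gap:
  assumes k: "k \<in> K" and x: "x \<in> {0..1}" "x \<in> gap M (b k) (d k)"
  shows "G M x = d k"
proof (rule antisym)
  have "x < d k" using x(2) by (auto simp: gap_def split: if_splits)
  then show "G M x \<le> d k" using G_le[OF x(1) d_in[OF k]] by simp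
  show "d k \<le> G M x"
  proof (rule ccontr)
    assume "\<not> d k \<le> G M x"
    then have "G M x \<in> gap M (b k) (d k)"
      using x(2) G_ge[OF x(1)] by (auto simp: gap_def split: if_splits)
    then show False using G_in[OF x(1)] gap_disjoint[OF k] by blast
  qed
qed

text \<open>
  An element \<open>m\<close> of \<open>M\<close> in \<open>[u, v)\<close> gives \<open>G M u \<le> m < v \<le> G M v\<close>; without one, the least
  element of \<open>M\<close> above \<open>u\<close> already lies above \<open>v\<close>.
\<close>

lemma G_eq_iff:
  assumes uv: "u \<in> {0..1}" "v \<in> {0..1}" "u \<le> v"
  shows "G M u = G M v \<longleftrightarrow> {u..<v} \<inter> M = {}"
proof
  assume eq: "G M u = G M v"
  have "v \<le> m" if "m \<in> M" "u \<le> m" for m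
    using G_ge[OF uv(2)] G_le[OF uv(1) that] eq by linarith
  then have "\<not> (u \<le> m \<and> m < v)" if "m \<in> M" for m
    using that by (meson not_le)
  then show "{u..<v} \<inter> M = {}" by auto
next
  assume disj: "{u..<v} \<inter> M = {}"
  have "G M u \<notin> {u..<v}" using disj G_in[OF uv(1)] by blast
  then have "v \<le> G M u" using G_ge[OF uv(1)] by simp
  then have "G M v \<le> G M u" by (rule G_le[OF uv(2) G_in[OF uv(1)]])
  moreover have "G M u \<le> G M v"
    using uv(3) G_ge[OF uv(2)] by (intro G_le[OF uv(1) G_in[OF uv(2)]]) linarith
  ultimately show "G M u = G M v" by simp
qed

lemma O_set_disjoint_iff:
  assumes A: "A \<subseteq> {0..1}"
  shows "O_set A \<inter> M = {} \<longleftrightarrow> (\<forall>u\<in>A. \<forall>v\<in>A. G M u = G M v)"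
proof -
  have piece: "{min u v..<max u v} \<inter> M = {} \<longleftrightarrow> G M u = G M v" if "u \<in> A" "v \<in> A" for u v
  proof -
    have "u \<in> {0..1}" "v \<in> {0..1}" using that A by blast+
    then show ?thesis
      using G_eq_iff[of u v] G_eq_iff[of v u]
      by (cases "u \<le> v") (simp_all add: eq_commute[of "G M u" "G M v"])
  qed
  have "O_set A \<inter> M = {} \<longleftrightarrow> (\<forall>u\<in>A. \<forall>v\<in>A. {min u v..<max u v} \<inter> M = {})"
    unfolding O_set_def by blast
  also have "\<dots> \<longleftrightarrow> (\<forall>u\<in>A. \<forall>v\<in>A. G M u = G M v)"
    by (intro ball_cong refl piece)
  finally show ?thesis .
qed

text \<open>
  Two specialisations to the shapes of \<open>A\<close> that occur: a base point joined with a family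
  (the images of \<^const>\<open>I_lower\<close> and \<^const>\<open>I_upper\<close>), and two non-empty families
  (\<^const>\<open>J_set\<close>), where comparing across the families already forces constancy within each.
\<close>

lemma O_set_insert_disjoint_iff:
  assumes "insert a B \<subseteq> {0..1}"
  shows "O_set (insert a B) \<inter> M = {} \<longleftrightarrow> (\<forall>u\<in>B. G M u = G M a)"
  unfolding O_set_disjoint_iff[OF assms]
proof
  assume base: "\<forall>u\<in>B. G M u = G M a"
  have "G M u = G M a" if "u \<in> insert a B" for u
    using that base by blast
  then show "\<forall>u\<in>insert a B. \<forall>v\<in>insert a B. G M u = G M v" by metis
qed blast

lemma O_set_Un_disjoint_iff:
  assumes "A \<union> B \<subseteq> {0..1}" "A \<noteq> {}" "B \<noteq> {}"
  shows "O_set (A \<union> B) \<inter> M = {} \<longleftrightarrow> (\<forall>u\<in>A. \<forall>v\<in>B. G M u = G M v)"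
  unfolding O_set_disjoint_iff[OF assms(1)]
proof
  assume across: "\<forall>u\<in>A. \<forall>v\<in>B. G M u = G M v"
  obtain a where a: "a \<in> A" using assms(2) by blast
  obtain v where v: "v \<in> B" using assms(3) by blast
  have "G M u = G M a" if "u \<in> A \<union> B" for u
  proof -
    have "G M a = G M v" using across a v by blast
    then show ?thesis using that across v a by (metis UnE)
  qed
  then show "\<forall>u\<in>A \<union> B. \<forall>v\<in>A \<union> B. G M u = G M v" by metis
qed blast


section \<open>Associativity case by case\<close>

context
  fixes T :: "real \<Rightarrow> real \<Rightarrow> real"
  assumes T_closed: "x \<in> {0..1} \<Longrightarrow> y \<in> {0..1} \<Longrightarrow> T x y \<in> {0..1}"
begin

text \<open>
  Each of the next three lemmas turns one part of \<^const>\<open>T_set\<close> into a family of single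
  equations, in the form that associativity takes in the corresponding case.
\<close>

lemma T1_set_disjoint_iff:
  "T1_set T M K b d \<inter> M = {} \<longleftrightarrow>
     (\<forall>x\<in>M. \<forall>y\<in>M. \<forall>z\<in>M. \<forall>k\<in>K. T x y \<in> gap M (b k) (d k) \<longrightarrow> T y z \<in> M \<longrightarrow>
        G M (T (T x y) z) = G M (T (d k) z))"
proof -
  have piece: "O_set ((\<lambda>x. T x z) ` I_lower T M (b k) (d k) y) \<inter> M = {} \<longleftrightarrow>
      (\<forall>x\<in>M. T x y \<in> gap M (b k) (d k) \<longrightarrow> G M (T (T x y) z) = G M (T (d k) z))"
    if "y \<in> M" "z \<in> M" "k \<in> K" for y z k
  proof -
    let ?B = "(\<lambda>x. T (T x y) z) ` M_lower T M (b k) (d k) y"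
    have eq: "(\<lambda>x. T x z) ` I_lower T M (b k) (d k) y = insert (T (d k) z) ?B"
      by (auto simp: I_lower_def)
    have "insert (T (d k) z) ?B \<subseteq> {0..1}"
      using that d_in[of k] in_I T_closed by (auto simp: M_lower_def simp del: atLeastAtMost_iff)
    from O_set_insert_disjoint_iff[OF this] show ?thesis
      unfolding eq by (auto simp: M_lower_def)
  qed
  have "T1_set T M K b d \<inter> M = {} \<longleftrightarrow>
      (\<forall>y\<in>M. \<forall>k\<in>K. \<forall>z\<in>M. T y z \<in> M \<longrightarrow>
         O_set ((\<lambda>x. T x z) ` I_lower T M (b k) (d k) y) \<inter> M = {})"
    unfolding T1_set_def M_right_def by blast
  then show ?thesis using piece by auto
qed

lemma T2_set_disjoint_iff:
  "T2_set T M K b d \<inter> M = {} \<longleftrightarrow>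
     (\<forall>x\<in>M. \<forall>y\<in>M. \<forall>z\<in>M. \<forall>l\<in>K. T x y \<in> M \<longrightarrow> T y z \<in> gap M (b l) (d l) \<longrightarrow>
        G M (T x (T y z)) = G M (T x (d l)))"
proof -
  have piece: "O_set (T x ` I_upper T M (b l) (d l) y) \<inter> M = {} \<longleftrightarrow>
      (\<forall>z\<in>M. T y z \<in> gap M (b l) (d l) \<longrightarrow> G M (T x (T y z)) = G M (T x (d l)))"
    if "y \<in> M" "x \<in> M" "l \<in> K" for y x l
  proof -
    let ?B = "(\<lambda>z. T x (T y z)) ` M_upper T M (b l) (d l) y"
    have eq: "T x ` I_upper T M (b l) (d l) y = insert (T x (d l)) ?B"
      by (auto simp: I_upper_def)
    have "insert (T x (d l)) ?B \<subseteq> {0..1}"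
      using that d_in[of l] in_I T_closed by (auto simp: M_upper_def simp del: atLeastAtMost_iff)
    from O_set_insert_disjoint_iff[OF this] show ?thesis
      unfolding eq by (auto simp: M_upper_def)
  qed
  have "T2_set T M K b d \<inter> M = {} \<longleftrightarrow>
      (\<forall>y\<in>M. \<forall>l\<in>K. \<forall>x\<in>M. T x y \<in> M \<longrightarrow>
         O_set (T x ` I_upper T M (b l) (d l) y) \<inter> M = {})"
    unfolding T2_set_def M_left_def by blast
  then show ?thesis using piece by auto
qed

lemma T3_set_disjoint_iff:
  "T3_set T M K b d \<inter> M = {} \<longleftrightarrow>
     (\<forall>x\<in>M. \<forall>y\<in>M. \<forall>z\<in>M. \<forall>k\<in>K. \<forall>l\<in>K.
        T x y \<in> gap M (b k) (d k) \<longrightarrow> T y z \<in> gap M (b l) (d l) \<longrightarrow>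
        G M (T x (d l)) = G M (T (d k) z))"
proof -
  have piece: "J_set T M b d k l y \<inter> M = {} \<longleftrightarrow>
      (\<forall>x\<in>M. \<forall>z\<in>M. T x y \<in> gap M (b k) (d k) \<longrightarrow> T y z \<in> gap M (b l) (d l) \<longrightarrow>
         G M (T x (d l)) = G M (T (d k) z))"
    if "y \<in> M" "k \<in> K" "l \<in> K" for y k l
  proof (cases "M_lower T M (b k) (d k) y = {} \<or> M_upper T M (b l) (d l) y = {}")
    case True
    \<comment> \<open>The empty default value of the set matches the vacuous right-hand side.\<close>
    then show ?thesis by (auto simp: J_set_def M_lower_def M_upper_def)
  next
    case False
    let ?A = "(\<lambda>x. T x (d l)) ` M_lower T M (b k) (d k) y"
    let ?B = "T (d k) ` M_upper T M (b l) (d l) y"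
    have "?A \<union> ?B \<subseteq> {0..1}"
      using that d_in[of k] d_in[of l] in_I T_closed
      by (auto simp: M_lower_def M_upper_def simp del: atLeastAtMost_iff)
    from O_set_Un_disjoint_iff[OF this] False show ?thesis
      by (auto simp: J_set_def M_lower_def M_upper_def)
  qed
  have "T3_set T M K b d \<inter> M = {} \<longleftrightarrow>
      (\<forall>y\<in>M. \<forall>k\<in>K. \<forall>l\<in>K. J_set T M b d k l y \<inter> M = {})"
    unfolding T3_set_def by blast
  then show ?thesis using piece by auto
qed

lemma semigroup_iff_T_set_disjoint:
  assumes assoc: "assoc_on {0..1} T"
  shows "semigroup_on M (otimes T M) \<longleftrightarrow> T_set T M K b d \<inter> M = {}"
proof -
  let ?op = "otimes T M"
  have T_in: "T x y \<in> {0..1}" if "x \<in> M" "y \<in> M" for x y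
    using that in_I T_closed by blast
  have T_assoc: "T (T x y) z = T x (T y z)" if "x \<in> M" "y \<in> M" "z \<in> M" for x y z
    using assoc that M_subset unfolding assoc_on_def by blast
  have op_M: "?op x y = T x y" if "T x y \<in> M" for x y
    using that by (simp add: otimes_def G_on_M)
  have op_gap: "?op x y = d k" if "x \<in> M" "y \<in> M" "k \<in> K" "T x y \<in> gap M (b k) (d k)" for x y k
    unfolding otimes_def using that by (intro G_on_gap T_in)
  have gap_not_M: "T x y \<notin> M" if "k \<in> K" "T x y \<in> gap M (b k) (d k)" for x y k
    using that gap_disjoint by blast
  have closed: "?op x y \<in> M" if "x \<in> M" "y \<in> M" for x y
    unfolding otimes_def using that by (intro G_in T_in)
  have "semigroup_on M ?op \<longleftrightarrow>
      (\<forall>x\<in>M. \<forall>y\<in>M. \<forall>z\<in>M. ?op (?op x y) z = ?op x (?op y z))"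
    using closed by (auto simp: semigroup_on_def assoc_on_def)
  also have "\<dots> \<longleftrightarrow>
      T1_set T M K b d \<inter> M = {} \<and> T2_set T M K b d \<inter> M = {} \<and> T3_set T M K b d \<inter> M = {}"
    (is "?assoc \<longleftrightarrow> ?disjoint")
  proof
    assume eq: ?assoc
    have "G M (T (T x y) z) = G M (T (d k) z)"
      if "x \<in> M" "y \<in> M" "z \<in> M" "k \<in> K" "T x y \<in> gap M (b k) (d k)" "T y z \<in> M" for x y z k
      using eq[rule_format, of x y z] that op_M[of y z] op_gap[of x y k] T_assoc[of x y z]
      by (simp add: otimes_def)
    moreover have "G M (T x (T y z)) = G M (T x (d l))"
      if "x \<in> M" "y \<in> M" "z \<in> M" "l \<in> K" "T x y \<in> M" "T y z \<in> gap M (b l) (d l)" for x y z l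
      using eq[rule_format, of x y z] that op_M[of x y] op_gap[of y z l] T_assoc[of x y z]
      by (simp add: otimes_def)
    moreover have "G M (T x (d l)) = G M (T (d k) z)"
      if "x \<in> M" "y \<in> M" "z \<in> M" "k \<in> K" "l \<in> K"
        "T x y \<in> gap M (b k) (d k)" "T y z \<in> gap M (b l) (d l)" for x y z k l
      using eq[rule_format, of x y z] that op_gap[of x y k] op_gap[of y z l]
      by (simp add: otimes_def)
    ultimately show ?disjoint
      unfolding T1_set_disjoint_iff T2_set_disjoint_iff T3_set_disjoint_iff by blast
  next
    assume disj: ?disjoint
    show ?assoc
    proof (intro ballI)
      fix x y z assume xyz: "x \<in> M" "y \<in> M" "z \<in> M"
      have xy: "T x y \<in> M \<or> (\<exists>k\<in>K. T x y \<in> gap M (b k) (d k))"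
        using gap_cover T_in xyz by blast
      have yz: "T y z \<in> M \<or> (\<exists>l\<in>K. T y z \<in> gap M (b l) (d l))"
        using gap_cover T_in xyz by blast
      consider (neither) "T x y \<in> M" "T y z \<in> M"
        | (left) k where "k \<in> K" "T x y \<in> gap M (b k) (d k)" "T y z \<in> M"
        | (right) l where "l \<in> K" "T x y \<in> M" "T y z \<in> gap M (b l) (d l)"
        | (both) k l where "k \<in> K" "l \<in> K"
            "T x y \<in> gap M (b k) (d k)" "T y z \<in> gap M (b l) (d l)"
        using xy yz by blast
      then show "?op (?op x y) z = ?op x (?op y z)"
      proof cases
        case neither
        then show ?thesis using T_assoc[OF xyz] by (simp add: op_M) (simp add: otimes_def)
      next
        case left
        then have "G M (T (T x y) z) = G M (T (d k) z)"
          using disj xyz unfolding T1_set_disjoint_iff by blast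
        then show ?thesis
          using left xyz T_assoc[OF xyz] op_M[of y z] op_gap[of x y k] by (simp add: otimes_def)
      next
        case right
        then have "G M (T x (T y z)) = G M (T x (d l))"
          using disj xyz unfolding T2_set_disjoint_iff by blast
        then show ?thesis
          using right xyz T_assoc[OF xyz] op_M[of x y] op_gap[of y z l] by (simp add: otimes_def)
      next
        case both
        then have "G M (T x (d l)) = G M (T (d k) z)"
          using disj xyz unfolding T3_set_disjoint_iff by blast
        then show ?thesis
          using both xyz op_gap[of x y k] op_gap[of y z l] by (simp add: otimes_def)
      qed
    qed
  qed
  also have "\<dots> \<longleftrightarrow> T_set T M K b d \<inter> M = {}"
    unfolding T_set_def by blast
  finally show ?thesis .
qed

end

end

theorem theorem5p1:
  fixes T :: "real \<Rightarrow> real \<Rightarrow> real" and f :: "real \<Rightarrow> real" and M :: "real set"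
    and K :: "'k set" and b d :: "'k \<Rightarrow> real" and K' :: "'l set" and c :: "'l \<Rightarrow> real"
  assumes "\<forall>x\<in>{0..1}. \<forall>y\<in>{0..1}. T x y \<in> {0..1}"
    and "assoc_on {0..1} T"
    and "monotone_op T"
    and "\<exists>e\<in>{0..1}. \<forall>x\<in>{0..1}. T e x = x \<and> T x e = x"
    and "unit_rc_mono f"
    and "\<not> f constant_on {0..1}"
    and "f 1 = 1"
    and "M = f ` {0..1}"
    and "associated_pair M K b d K' c"
  shows "semigroup_on M (otimes T M) \<longleftrightarrow> T_set T M K b d \<inter> M = {}"
proof -
  interpret gap_family M K b d
    using assms(5,7,8,9) by (rule gap_familyI)
  show ?thesis
    using assms(1,2) by (intro semigroup_iff_T_set_disjoint) blast+
qed

end
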